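(* Let $\mathbf a$ be a non-empty admissible composition. For all $m,n\in\mathbf N$, $$\zeta(\mathbf a)_{m,n}\le \frac{m^m n^n}{(m+n)^{m+n}}\,\zeta(\mathbf a),$$ and $\zeta(\mathbf a)\le \pi^2/6$. In particular, for all $n\in\mathbf N$, $\zeta(\mathbf a)_{n,n}\le 2^{-2n}\zeta(\mathbf a)\le 2^{-2n}\pi^2/6$.
   Context: $\mathbf N$ denotes the set of non-negative integers; the convention $0^0=1$ is used. A composition is a finite sequence $\mathbf a=(a_1,\ldots,a_r)$ of positive integers; it is admissible if either $r\ge1$ and $a_1\ge 2$, or $r=0$. For non-empty admissible $\mathbf a$, $\zeta(\mathbf a)=\sum_{n_1>\cdots>n_r>0}n_1^{-a_1}\cdots n_r^{-a_r}$. The associated binary word is $\mathbf w(\mathbf a)=\{0\}_{a_1-1}1\cdots\{0\}_{a_r-1}1$, where $\{0\}_u$ is the word of $u$ letters $0$. Set $f_0(t)=1/t$, $f_1(t)=1/(1-t)$. For $\mathbf w(\mathbf a)=\varepsilon_1\ldots\varepsilon_k$ and $m,n\in\mathbf N$, $$\zeta(\mathbf a)_{m,n}=\int_{1>t_1>\cdots>t_k>0}(1-t_1)^m f_{\varepsilon_1}(t_1)\cdots f_{\varepsilon_k}(t_k)\,t_k^n\,dt_1\cdots dt_k .$$ *)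

theory Defs
  imports "HOL-Analysis.Analysis"
begin

definition composition :: "nat list \<Rightarrow> bool" where
  "composition a \<longleftrightarrow> (\<forall>x\<in>set a. 0 < x)"

definition admissible :: "nat list \<Rightarrow> bool" where
  "admissible a \<longleftrightarrow> composition a \<and> (a = [] \<or> 2 \<le> hd a)"

definition decreasing_tuples :: "nat \<Rightarrow> nat list set" where
  "decreasing_tuples r = {ns. length ns = r \<and> sorted_wrt (>) ns \<and> (\<forall>x\<in>set ns. 0 < x)}"

definition mzv :: "nat list \<Rightarrow> real" where
  "mzv a = (\<Sum>\<^sub>\<infinity>ns\<in>decreasing_tuples (length a). \<Prod>i<length a. 1 / real (ns ! i) ^ (a ! i))"

definition binary_word :: "nat list \<Rightarrow> nat list" where
  "binary_word a = concat (map (\<lambda>x. replicate (x - 1) 0 @ [1]) a)"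

definition letter_form :: "nat \<Rightarrow> real \<Rightarrow> real" where
  "letter_form e t = (if e = 0 then 1 / t else 1 / (1 - t))"

text \<open>Coordinates are indexed from 0: \<open>t i\<close> stands for $t_{i+1}$.\<close>

definition open_simplex :: "nat \<Rightarrow> (nat \<Rightarrow> real) set" where
  "open_simplex k = {t \<in> {..<k} \<rightarrow>\<^sub>E UNIV.
     (\<forall>i<k. 0 < t i \<and> t i < 1) \<and> (\<forall>i j. i < j \<and> j < k \<longrightarrow> t j < t i)}"

text \<open>Meaningful for \<open>a \<noteq> []\<close> only, since \<open>t 0\<close> and \<open>t (k - 1)\<close> must be coordinates.\<close>

definition mzv_tail :: "nat list \<Rightarrow> nat \<Rightarrow> nat \<Rightarrow> real" where
  "mzv_tail a m n =
     (let w = binary_word a; k = length w in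
      LINT t:open_simplex k|(\<Pi>\<^sub>M i\<in>{..<k}. lborel).
        (1 - t 0) ^ m * (\<Prod>i<k. letter_form (w ! i) (t i)) * t (k - 1) ^ n)"

end

theory Submission imports Defs begin

text \<open>On the simplex \<open>t\<^sub>k \<le> t\<^sub>1\<close>, so \<open>(1 - t\<^sub>1)^m * t\<^sub>k^n\<close> is at most the maximum of
  \<open>(1 - t)^m * t^n\<close> on the unit interval, and the first inequality reduces to the iterated
  integral representation of \<open>\<zeta>(a)\<close>. That representation follows by integrating out the
  innermost variable repeatedly: each letter maps a power series with nonnegative coefficients
  to another one, and the partial sums of the final coefficients are the truncations of \<open>\<zeta>(a)\<close>.

  For the bound by \<open>\<zeta>(2)\<close>, telescoping gives \<open>\<Sum>\<^sub>n\<^sub>>\<^sub>m n^(-x) \<le> 1/m\<close> for \<open>x \<ge> 2\<close>, hence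
  \<open>\<zeta>(x, y, \<dots>) \<le> \<zeta>(y + 1, \<dots>)\<close>, and the depth drops to 1 by induction.\<close>

section \<open>Truncated multiple zeta values and their bound by
  \<open>pi\<^sup>2 / 6\<close>\<close>

primrec trunc_mzv :: "nat list \<Rightarrow> nat \<Rightarrow> real" where
  "trunc_mzv [] N = 1"
| "trunc_mzv (x # a) N = (\<Sum>n\<in>{1..<N}. trunc_mzv a n / real n ^ x)"

lemma trunc_mzv_nonneg: "0 \<le> trunc_mzv a N"
  by (induction a arbitrary: N) (auto intro!: sum_nonneg)

lemma sum_inverse_power_tail_le:
  assumes "2 \<le> x" "0 < m"
  shows "(\<Sum>n\<in>{m<..<N}. 1 / real n ^ x) \<le> 1 / real m"
proof -
  have "(\<Sum>n\<in>{m<..<N}. 1 / real n ^ x) \<le> (\<Sum>n\<in>{m<..<N}. 1 / real (n - 1) - 1 / real n)"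
  proof (rule sum_mono)
    fix n assume n: "n \<in> {m<..<N}"
    then have n2: "n \<ge> 2" using assms by auto
    have "real n ^ 2 \<le> real n ^ x" using assms n2 by (intro power_increasing) auto
    then have "1 / real n ^ x \<le> 1 / real n ^ 2" using n2 by (intro divide_left_mono) auto
    also have "\<dots> \<le> 1 / real (n - 1) - 1 / real n"
      using n2 by (simp add: of_nat_diff field_simps power2_eq_square)
    finally show "1 / real n ^ x \<le> 1 / real (n - 1) - 1 / real n" .
  qed
  also have "\<dots> \<le> 1 / real m"
  proof (cases "m < N")
    case True
    then have "(\<Sum>n\<in>{m<..<N}. 1 / real (n - 1) - 1 / real n) = 1 / real m - 1 / real (N - 1)"
    proof (induction N)
      case (Suc N)
      have "{m<..<Suc N} = (if m < N then insert N {m<..<N} else {})"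
        using Suc.prems by auto
      with Suc show ?case by (cases "m = N") auto
    qed auto
    then show ?thesis by simp
  qed auto
  finally show ?thesis .
qed

text \<open>Exchanging the two outermost sums puts the largest index innermost. Its tail sum is at
  most \<open>1 / m\<close>, which is absorbed as one more power of the second index
  \<open>m\<close>.\<close>

lemma trunc_mzv_contract:
  assumes "2 \<le> x"
  shows "trunc_mzv (x # y # a) N \<le> trunc_mzv (Suc y # a) N"
proof -
  have "trunc_mzv (x # y # a) N =
      (\<Sum>n\<in>{1..<N}. \<Sum>m\<in>{1..<n}. trunc_mzv a m / real m ^ y * (1 / real n ^ x))"
    by (simp add: sum_divide_distrib)
  also have "\<dots> = (\<Sum>m\<in>{1..<N}. \<Sum>n\<in>{m<..<N}. trunc_mzv a m / real m ^ y * (1 / real n ^ x))"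
    unfolding sum.Sigma[OF finite_atLeastLessThan ballI[OF finite_atLeastLessThan]]
      sum.Sigma[OF finite_atLeastLessThan ballI[OF finite_greaterThanLessThan]]
    by (rule sum.reindex_bij_witness[where i="\<lambda>(m, n). (n, m)" and j="\<lambda>(n, m). (m, n)"]) auto
  also have "\<dots> \<le> (\<Sum>m\<in>{1..<N}. trunc_mzv a m / real m ^ y * (1 / real m))"
    unfolding sum_distrib_left[symmetric] using assms
    by (intro sum_mono mult_left_mono sum_inverse_power_tail_le)
       (auto simp: trunc_mzv_nonneg)
  also have "\<dots> = trunc_mzv (Suc y # a) N"
    by (simp add: mult.commute)
  finally show ?thesis .
qed

lemma trunc_mzv_le_zeta2:
  assumes "2 \<le> x" "composition a"
  shows "trunc_mzv (x # a) N \<le> pi\<^sup>2 / 6"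
  using assms
proof (induction a arbitrary: x)
  case Nil
  have "trunc_mzv [x] N \<le> (\<Sum>n\<in>{1..<N}. 1 / real n ^ 2)"
    unfolding trunc_mzv.simps using Nil
    by (intro sum_mono divide_left_mono power_increasing) auto
  also have "\<dots> = (\<Sum>n<N - 1. 1 / (1 + real n)\<^sup>2)"
    by (rule sum.reindex_bij_witness[where i=Suc and j="\<lambda>n. n - 1"]) (auto simp: of_nat_diff)
  also have "\<dots> \<le> (\<Sum>n. 1 / (1 + real n)\<^sup>2)"
    using inverse_squares_sums by (intro sum_le_suminf) (auto simp: sums_iff)
  also have "\<dots> = pi\<^sup>2 / 6"
    using inverse_squares_sums by (simp add: sums_iff field_simps)
  finally show ?case .
next
  case (Cons y a)
  have "trunc_mzv (x # y # a) N \<le> trunc_mzv (Suc y # a) N"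
    by (rule trunc_mzv_contract[OF Cons.prems(1)])
  \<comment> \<open>Positivity of \<open>y\<close> gives \<open>2 \<le> Suc y\<close>, so the
    condition on the leading exponent survives the contraction.\<close>
  also have "\<dots> \<le> pi\<^sup>2 / 6"
    using Cons.prems by (intro Cons.IH) (auto simp: composition_def)
  finally show ?case .
qed


section \<open>Truncations as finite partial sums of the multiple zeta series\<close>

definition bounded_tuples :: "nat \<Rightarrow> nat \<Rightarrow> nat list set" where
  "bounded_tuples r N = {ns \<in> decreasing_tuples r. \<forall>x\<in>set ns. x < N}"

lemma finite_bounded_tuples: "finite (bounded_tuples r N)"
proof (rule finite_subset)
  show "bounded_tuples r N \<subseteq> {ns. set ns \<subseteq> {..<N} \<and> length ns = r}"
    by (auto simp: bounded_tuples_def decreasing_tuples_def)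
qed (simp add: finite_lists_length_eq)

lemma bounded_tuples_0: "bounded_tuples 0 N = {[]}"
  by (auto simp: bounded_tuples_def decreasing_tuples_def)

lemma bounded_tuples_Suc:
  "bounded_tuples (Suc r) N = (\<lambda>(n, ns). n # ns) ` (SIGMA n:{1..<N}. bounded_tuples r n)"
proof (intro set_eqI iffI)
  fix ns assume "ns \<in> bounded_tuples (Suc r) N"
  then show "ns \<in> (\<lambda>(n, ns). n # ns) ` (SIGMA n:{1..<N}. bounded_tuples r n)"
    by (cases ns) (auto simp: bounded_tuples_def decreasing_tuples_def image_iff)
next
  fix ns assume "ns \<in> (\<lambda>(n, ns). n # ns) ` (SIGMA n:{1..<N}. bounded_tuples r n)"
  then show "ns \<in> bounded_tuples (Suc r) N"
    by (force simp: bounded_tuples_def decreasing_tuples_def)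
qed

text \<open>Splitting off the largest entry \<open>n\<close> leaves a tuple with all entries below
  \<open>n\<close>, which is the recursion of \<open>trunc_mzv\<close>.\<close>

lemma sum_bounded_tuples:
  "(\<Sum>ns\<in>bounded_tuples (length a) N. \<Prod>i<length a. 1 / real (ns ! i) ^ (a ! i)) = trunc_mzv a N"
proof (induction a arbitrary: N)
  case Nil
  then show ?case by (simp add: bounded_tuples_0)
next
  case (Cons x a)
  have inj: "inj_on (\<lambda>(n, ns). n # ns) (SIGMA n:{1..<N}. bounded_tuples (length a) n)"
    by (auto simp: inj_on_def)
  have "(\<Sum>ns\<in>bounded_tuples (length (x # a)) N.
          \<Prod>i<length (x # a). 1 / real (ns ! i) ^ ((x # a) ! i))
      = (\<Sum>(n, ns)\<in>(SIGMA n:{1..<N}. bounded_tuples (length a) n).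
          1 / real n ^ x * (\<Prod>i<length a. 1 / real (ns ! i) ^ (a ! i)))"
    unfolding list.size(4) add_0_right add_Suc_right bounded_tuples_Suc sum.reindex[OF inj]
    by (intro sum.cong) (auto simp: prod.lessThan_Suc_shift simp del: prod.lessThan_Suc)
  also have "\<dots> = trunc_mzv (x # a) N"
    by (simp add: sum.Sigma[symmetric] finite_bounded_tuples sum_divide_distrib[symmetric] Cons.IH)
  finally show ?case .
qed

text \<open>The truncations are cofinal among the finite index sets, so a uniform bound on them
  bounds every finite partial sum.\<close>

lemma decreasing_tuples_subset_bounded:
  assumes "finite F" "F \<subseteq> decreasing_tuples r"
  obtains N where "F \<subseteq> bounded_tuples r N"
proof -
  have "finite (\<Union>ns\<in>F. set ns)" using assms by auto
  then obtain N where "\<forall>x\<in>(\<Union>ns\<in>F. set ns). x < N"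
    using finite_nat_set_iff_bounded by blast
  then have "F \<subseteq> bounded_tuples r N" using assms by (auto simp: bounded_tuples_def)
  then show ?thesis by (rule that)
qed

text \<open>An infinite sum has the default value 0 when it diverges, so summability comes first. It
  follows from nonnegativity and the uniform bound on finite partial sums, and both claims rest on
  it.\<close>

lemma
  assumes "admissible a" "a \<noteq> []"
  shows mzv_le_zeta2: "mzv a \<le> pi\<^sup>2 / 6"
    and trunc_mzv_le_mzv: "trunc_mzv a N \<le> mzv a"
proof -
  let ?f = "\<lambda>ns. \<Prod>i<length a. 1 / real (ns ! i) ^ (a ! i)"
  let ?D = "decreasing_tuples (length a)"
  obtain x b where a: "a = x # b" "2 \<le> x" "composition b"
    using assms by (cases a) (auto simp: admissible_def composition_def)
  have nonneg: "0 \<le> ?f ns" for ns by (intro prod_nonneg) auto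
  have bound: "sum ?f F \<le> pi\<^sup>2 / 6" if F: "finite F" "F \<subseteq> ?D" for F
  proof -
    obtain N where "F \<subseteq> bounded_tuples (length a) N"
      using decreasing_tuples_subset_bounded[OF F] .
    then have "sum ?f F \<le> trunc_mzv a N"
      unfolding sum_bounded_tuples[symmetric]
      by (intro sum_mono2 finite_bounded_tuples nonneg)
    also have "\<dots> \<le> pi\<^sup>2 / 6" using trunc_mzv_le_zeta2 a by blast
    finally show ?thesis .
  qed
  have summable: "?f summable_on ?D"
    by (intro nonneg_bdd_above_summable_on nonneg bdd_aboveI2[where M="pi\<^sup>2 / 6"])
       (use bound in blast)
  show "mzv a \<le> pi\<^sup>2 / 6"
    unfolding mzv_def by (rule infsum_le_finite_sums[OF summable bound])
  show "trunc_mzv a N \<le> mzv a"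
    unfolding mzv_def sum_bounded_tuples[symmetric]
    by (intro finite_sum_le_infsum summable finite_bounded_tuples nonneg)
       (auto simp: bounded_tuples_def)
qed

section \<open>Integrating one letter against a power series\<close>

definition power_series :: "(nat \<Rightarrow> real) \<Rightarrow> real \<Rightarrow> ennreal" where
  "power_series c t = (\<Sum>n. ennreal (c n * t ^ n))"

text \<open>The coefficients of the primitive of \<open>letter_form e t * power_series c t\<close>;
  the constant coefficient is 0 because division by 0 gives 0.\<close>

definition letter_step :: "nat \<Rightarrow> (nat \<Rightarrow> real) \<Rightarrow> nat \<Rightarrow> real" where
  "letter_step e c n = (if e = 0 then c n else (\<Sum>k<n. c k)) / real n"

lemma letter_step_nonneg: "(\<And>n. 0 \<le> c n) \<Longrightarrow> 0 \<le> letter_step e c n"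
  by (simp add: letter_step_def sum_nonneg)

lemma measurable_power_series [measurable]: "power_series c \<in> borel_measurable borel"
  unfolding power_series_def by measurable

lemma measurable_letter_form [measurable]: "letter_form e \<in> borel_measurable borel"
  unfolding letter_form_def by measurable

text \<open>Cauchy product with the geometric series: the coefficients become partial sums. The
  exponent is \<open>n - 1\<close> because the series is to be integrated next; the term at
  \<open>n = 0\<close> is an empty sum.\<close>

lemma geometric_mult_power_series:
  assumes c: "\<And>n. 0 \<le> c n" and t: "0 < t" "t < 1"
  shows "ennreal (1 / (1 - t)) * power_series c t = (\<Sum>n. ennreal ((\<Sum>k<n. c k) * t ^ (n - 1)))"
proof -
  define f where "f k n = (if k < n then ennreal (c k * t ^ (n - 1)) else 0)" for k n
  have geo: "(\<Sum>j. ennreal (t ^ j)) = ennreal (1 / (1 - t))"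
    using t by (intro suminf_ennreal_eq geometric_sums) auto
  have "(\<Sum>n. ennreal ((\<Sum>k<n. c k) * t ^ (n - 1))) = (\<Sum>n. \<Sum>k. f k n)"
  proof (rule suminf_cong)
    fix n
    have "(\<Sum>k. f k n) = (\<Sum>k<n. f k n)"
      by (rule suminf_finite) (auto simp: f_def)
    also have "\<dots> = ennreal (\<Sum>k<n. c k * t ^ (n - 1))"
      using c t by (subst sum_ennreal[symmetric]) (auto simp: f_def)
    finally show "ennreal ((\<Sum>k<n. c k) * t ^ (n - 1)) = (\<Sum>k. f k n)"
      by (simp add: sum_distrib_right)
  qed
  \<comment> \<open>Tonelli for a double series, one of the sums being read as an integral over
    counting measure.\<close>
  also have "\<dots> = (\<Sum>k. \<Sum>n. f k n)"
    using nn_integral_suminf[of f "count_space UNIV"] by (simp add: nn_integral_count_space_nat)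
  also have "\<dots> = (\<Sum>k. ennreal (c k * t ^ k) * ennreal (1 / (1 - t)))"
  proof (rule suminf_cong)
    fix k
    have "(\<Sum>n. f k n) = (\<Sum>j. f k (j + Suc k)) + (\<Sum>j<Suc k. f k j)"
      by (rule suminf_offset) simp
    also have "(\<Sum>j<Suc k. f k j) = 0"
      by (intro sum.neutral) (auto simp: f_def)
    also have "(\<Sum>j. f k (j + Suc k)) = (\<Sum>j. ennreal (c k * t ^ k) * ennreal (t ^ j))"
      using c t by (intro suminf_cong) (auto simp: f_def ennreal_mult[symmetric] power_add mult_ac)
    finally show "(\<Sum>n. f k n) = ennreal (c k * t ^ k) * ennreal (1 / (1 - t))"
      by (simp add: geo)
  qed
  finally show ?thesis
    by (simp add: power_series_def mult.commute)
qed

text \<open>The right-hand side is expanded in the derivatives of \<open>t ^ n\<close>, ready for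
  termwise integration. For the letter 0 a constant coefficient would contribute
  \<open>c 0 / t\<close>, which has no such expansion; hence the condition on
  \<open>c 0\<close>.\<close>

lemma letter_form_mult_power_series:
  assumes c: "\<And>n. 0 \<le> c n" "e = 0 \<Longrightarrow> c 0 = 0" and t: "0 < t" "t < 1"
  shows "ennreal (letter_form e t) * power_series c t
    = (\<Sum>n. ennreal (letter_step e c n) * ennreal (real n * t ^ (n - 1)))"
proof (cases "e = 0")
  case True
  have "ennreal (1 / t) * power_series c t = (\<Sum>n. ennreal (1 / t) * ennreal (c n * t ^ n))"
    by (simp add: power_series_def)
  also have "\<dots> = (\<Sum>n. ennreal (letter_step e c n) * ennreal (real n * t ^ (n - 1)))"
  proof (rule suminf_cong)
    fix n
    show "ennreal (1 / t) * ennreal (c n * t ^ n)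
        = ennreal (letter_step e c n) * ennreal (real n * t ^ (n - 1))"
      using c t True
      by (cases n) (auto simp: letter_step_def ennreal_mult[symmetric] simp del: of_nat_Suc)
  qed
  finally show ?thesis using True by (simp add: letter_form_def)
next
  case False
  have "ennreal (letter_step e c n) * ennreal (real n * t ^ (n - 1))
      = ennreal ((\<Sum>k<n. c k) * t ^ (n - 1))" for n
    using c t False letter_step_nonneg[of c e n]
    by (cases "n = 0") (auto simp: letter_step_def ennreal_mult[symmetric])
  with False geometric_mult_power_series[OF c(1) t] show ?thesis
    by (simp add: letter_form_def)
qed

lemma nn_integral_power:
  assumes "0 \<le> x" "0 < n"
  shows "(\<integral>\<^sup>+t. ennreal (real n * t ^ (n - 1)) * indicator {0<..<x} t \<partial>lborel) = ennreal (x ^ n)"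
proof -
  \<comment> \<open>The endpoints form a null set; adding them allows the fundamental theorem of
    calculus on a closed interval.\<close>
  have "(\<integral>\<^sup>+t. ennreal (real n * t ^ (n - 1)) * indicator {0<..<x} t \<partial>lborel)
      = (\<integral>\<^sup>+t. ennreal (real n * t ^ (n - 1)) * indicator {0..x} t \<partial>lborel)"
    using AE_lborel_singleton[of 0] AE_lborel_singleton[of x]
    by (intro nn_integral_cong_AE) (auto simp: indicator_def elim: eventually_elim2)
  also have "\<dots> = ennreal (x ^ n) - ennreal (0 ^ n)"
    using assms by (subst nn_integral_FTC_Icc[where F="\<lambda>t. t ^ n"])
      (auto intro!: derivative_eq_intros simp: ennreal_minus)
  finally show ?thesis using assms by (simp add: zero_power)
qed

text \<open>All terms are nonnegative and values lie in \<open>ennreal\<close>, so sum and integral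
  commute even at \<open>x = 1\<close>, where convergence is not known.\<close>

lemma nn_integral_letter_form_power_series:
  assumes c: "\<And>n. 0 \<le> c n" "e = 0 \<Longrightarrow> c 0 = 0" and x: "0 \<le> x" "x \<le> 1"
  shows "(\<integral>\<^sup>+t. indicator {0<..<x} t * ennreal (letter_form e t) * power_series c t \<partial>lborel)
    = power_series (letter_step e c) x"
proof -
  have "(\<integral>\<^sup>+t. indicator {0<..<x} t * ennreal (letter_form e t) * power_series c t \<partial>lborel)
      = (\<integral>\<^sup>+t. (\<Sum>n. ennreal (letter_step e c n) *
          (ennreal (real n * t ^ (n - 1)) * indicator {0<..<x} t)) \<partial>lborel)"
    using x letter_form_mult_power_series[where c=c and e=e] c
    by (intro nn_integral_cong) (auto simp: indicator_def)
  also have "\<dots> = (\<Sum>n. ennreal (letter_step e c n) *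
      (\<integral>\<^sup>+t. ennreal (real n * t ^ (n - 1)) * indicator {0<..<x} t \<partial>lborel))"
    by (subst nn_integral_suminf) (auto simp: nn_integral_cmult)
  also have "\<dots> = power_series (letter_step e c) x"
    unfolding power_series_def
  proof (rule suminf_cong)
    fix n
    \<comment> \<open>For \<open>n = 0\<close> the integral formula would fail, but both sides
      vanish since \<open>letter_step e c 0\<close> is a quotient by 0.\<close>
    show "ennreal (letter_step e c n) *
        (\<integral>\<^sup>+t. ennreal (real n * t ^ (n - 1)) * indicator {0<..<x} t \<partial>lborel)
      = ennreal (letter_step e c n * x ^ n)"
      using x c letter_step_nonneg[of c e n]
      by (cases "n = 0") (simp_all add: nn_integral_power ennreal_mult letter_step_def[of _ _ 0] del: One_nat_def)
  qed
  finally show ?thesis .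
qed

section \<open>The iterated integral, one variable at a time\<close>

definition pred_coord :: "(nat \<Rightarrow> real) \<Rightarrow> nat \<Rightarrow> real" where
  "pred_coord t i = (if i = 0 then 1 else t (i - 1))"

text \<open>The simplex is encoded by one indicator per coordinate,
  \<open>0 < t i < t (i - 1)\<close>, with 1 in place of the coordinate before the first. Appending
  a letter then only multiplies by a factor in the new variable.\<close>

definition word_form :: "nat list \<Rightarrow> (nat \<Rightarrow> real) \<Rightarrow> ennreal" where
  "word_form w t =
     (\<Prod>i<length w. indicator {0<..<pred_coord t i} (t i) * ennreal (letter_form (w ! i) (t i)))"

lemma measurable_pred_coord:
  "i \<le> k \<Longrightarrow> (\<lambda>t. pred_coord t i) \<in> borel_measurable (\<Pi>\<^sub>M i\<in>{..<k}. lborel)"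
  by (cases i) (auto simp: pred_coord_def intro: measurable_component_singleton)

lemma measurable_word_form:
  assumes "length w \<le> k"
  shows "word_form w \<in> borel_measurable (\<Pi>\<^sub>M i\<in>{..<k}. lborel)"
  unfolding word_form_def
proof (intro borel_measurable_prod_ennreal borel_measurable_times_ennreal)
  fix i assume "i \<in> {..<length w}"
  with assms have i: "i < k" by simp
  have [measurable]: "(\<lambda>t. t i) \<in> borel_measurable (\<Pi>\<^sub>M i\<in>{..<k}. lborel :: real measure)"
    using i by (auto intro: measurable_component_singleton)
  have [measurable]: "(\<lambda>t. pred_coord t i) \<in> borel_measurable (\<Pi>\<^sub>M i\<in>{..<k}. lborel)"
    using i by (intro measurable_pred_coord) auto
  have "(\<lambda>t. if 0 < t i \<and> t i < pred_coord t i then 1 else 0 :: ennreal)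
      \<in> borel_measurable (\<Pi>\<^sub>M i\<in>{..<k}. lborel)"
    by measurable
  then show "(\<lambda>t. indicator {0<..<pred_coord t i} (t i) :: ennreal)
      \<in> borel_measurable (\<Pi>\<^sub>M i\<in>{..<k}. lborel)"
    by (simp add: indicator_def)
  show "(\<lambda>t. ennreal (letter_form (w ! i) (t i))) \<in> borel_measurable (\<Pi>\<^sub>M i\<in>{..<k}. lborel)"
    by measurable
qed

text \<open>A nonzero product has every indicator equal to 1, which gives the chain of inequalities
  below 1. This places the upper limit of the innermost integral in the unit interval.\<close>

lemma pred_coord_bounds:
  assumes "word_form w t \<noteq> 0" "i \<le> length w"
  shows "0 < pred_coord t i \<and> pred_coord t i \<le> 1"
  using assms(2)
proof (induction i)
  case 0
  then show ?case by (simp add: pred_coord_def)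
next
  case (Suc i)
  with assms(1) have "t i \<in> {0<..<pred_coord t i}"
    by (auto simp: word_form_def indicator_def split: if_splits)
  with Suc show ?case by (auto simp: pred_coord_def)
qed

lemma word_form_snoc:
  "word_form (w @ [e]) (t(length w := y)) = word_form w t *
     (indicator {0<..<pred_coord t (length w)} y * ennreal (letter_form e y))"
proof -
  have "pred_coord (t(length w := y)) i = pred_coord t i" if "i \<le> length w" for i
    using that by (auto simp: pred_coord_def)
  then show ?thesis by (simp add: word_form_def nth_append)
qed

text \<open>Induction from the right: integrating out the last variable gives a power series in the
  preceding one, hence the general \<open>c\<close>. The condition for a last letter 0 concerns the
  first integration alone, since each \<open>letter_step\<close> yields constant coefficient
  0.\<close>

lemma nn_integral_word_form:
  assumes "\<And>n. 0 \<le> c n" "w \<noteq> [] \<Longrightarrow> last w = 0 \<Longrightarrow> c 0 = 0"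
  shows "(\<integral>\<^sup>+t. word_form w t * power_series c (pred_coord t (length w)) \<partial>(\<Pi>\<^sub>M i\<in>{..<length w}. lborel))
    = power_series (foldr letter_step w c) 1"
  using assms
proof (induction w arbitrary: c rule: rev_induct)
  case Nil
  then show ?case by (simp add: word_form_def pred_coord_def PiM_empty nn_integral_count_space_finite)
next
  case (snoc e w)
  interpret product_sigma_finite "\<lambda>_::nat. lborel :: real measure"
    by standard
  let ?k = "length w"
  let ?F = "\<lambda>t. word_form (w @ [e]) t * power_series c (pred_coord t (Suc ?k))"
  have [measurable]: "word_form (w @ [e]) \<in> borel_measurable (\<Pi>\<^sub>M i\<in>{..<Suc ?k}. lborel)"
    by (rule measurable_word_form) simp
  have [measurable]: "(\<lambda>t. pred_coord t (Suc ?k)) \<in> borel_measurable (\<Pi>\<^sub>M i\<in>{..<Suc ?k}. lborel)"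
    by (rule measurable_pred_coord) simp
  have meas: "?F \<in> borel_measurable (\<Pi>\<^sub>M i\<in>insert ?k {..<?k}. lborel)"
    unfolding lessThan_Suc[symmetric] by measurable
  have "(\<integral>\<^sup>+t. ?F t \<partial>(\<Pi>\<^sub>M i\<in>{..<Suc ?k}. lborel))
      = (\<integral>\<^sup>+t. \<integral>\<^sup>+y. ?F (t(?k := y)) \<partial>lborel \<partial>(\<Pi>\<^sub>M i\<in>{..<?k}. lborel))"
    unfolding lessThan_Suc by (rule product_nn_integral_insert[OF _ _ meas]) auto
  also have "\<dots> = (\<integral>\<^sup>+t. word_form w t * power_series (letter_step e c) (pred_coord t ?k)
      \<partial>(\<Pi>\<^sub>M i\<in>{..<?k}. lborel))"
  proof (rule nn_integral_cong)
    fix t :: "nat \<Rightarrow> real"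
    have "(\<integral>\<^sup>+y. ?F (t(?k := y)) \<partial>lborel) = word_form w t *
        (\<integral>\<^sup>+y. indicator {0<..<pred_coord t ?k} y * ennreal (letter_form e y) * power_series c y \<partial>lborel)"
      by (subst nn_integral_cmult[symmetric])
         (auto simp: word_form_snoc pred_coord_def[of _ "Suc _"] mult.assoc)
    also have "\<dots> = word_form w t * power_series (letter_step e c) (pred_coord t ?k)"
    \<comment> \<open>Where the word form vanishes, the upper limit may lie outside the unit
      interval; the factor 0 settles that case.\<close>
    proof (cases "word_form w t = 0")
      case False
      have "0 < pred_coord t ?k \<and> pred_coord t ?k \<le> 1"
        by (rule pred_coord_bounds[OF False order_refl])
      with snoc.prems show ?thesis
        by (subst nn_integral_letter_form_power_series) auto
    qed auto
    finally show "(\<integral>\<^sup>+y. ?F (t(?k := y)) \<partial>lborel)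
      = word_form w t * power_series (letter_step e c) (pred_coord t ?k)" .
  qed
  also have "\<dots> = power_series (foldr letter_step w (letter_step e c)) 1"
    using snoc.prems by (intro snoc.IH letter_step_nonneg) (auto simp: letter_step_def)
  finally show ?case by simp
qed

section \<open>Series coefficients attached to the word of a composition\<close>

definition unit_coeff :: "nat \<Rightarrow> real" where
  "unit_coeff n = (if n = 0 then 1 else 0)"

lemma foldr_letter_step_zeros:
  "foldr letter_step (replicate j 0) c n = (if j = 0 then c n else c n / real n ^ j)"
  by (induction j) (auto simp: letter_step_def)

text \<open>In the block of \<open>x\<close>, the letter 1 takes partial sums over
  \<open>k < n\<close> and divides by \<open>n\<close>; the \<open>x - 1\<close> zeros divide by the
  remaining powers of \<open>n\<close>. So the coefficient at positive \<open>n\<close> is the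
  summand of \<open>trunc_mzv\<close>. For \<open>N = 0\<close> and the empty composition the two
  sides would be 0 and 1.\<close>

lemma sum_coeff_binary_word:
  assumes "composition a" "0 < N"
  shows "(\<Sum>n<N. foldr letter_step (binary_word a) unit_coeff n) = trunc_mzv a N"
  using assms
proof (induction a arbitrary: N)
  case Nil
  then show ?case by (simp add: binary_word_def unit_coeff_def sum.delta)
next
  case (Cons x a)
  let ?c = "foldr letter_step (binary_word a) unit_coeff"
  have x: "0 < x" and a: "composition a" using Cons.prems by (auto simp: composition_def)
  have word: "binary_word (x # a) = replicate (x - 1) 0 @ 1 # binary_word a"
    by (simp add: binary_word_def)
  have "foldr letter_step (binary_word (x # a)) unit_coeff n
      = foldr letter_step (replicate (x - 1) 0) (letter_step 1 ?c) n" for n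
    by (simp add: word del: foldr_replicate)
  also have "\<dots> n = (if n = 0 then 0 else trunc_mzv a n / real n ^ x)" for n
    using x Cons.IH[OF a, of n] unfolding foldr_letter_step_zeros
    by (cases x) (auto simp: letter_step_def[of "Suc 0"] field_simps)
  finally have coeff: "foldr letter_step (binary_word (x # a)) unit_coeff n
      = (if n = 0 then 0 else trunc_mzv a n / real n ^ x)" for n .
  have "{..<N} = insert 0 {1..<N}" using Cons.prems by auto
  then show ?case by (simp add: coeff)
qed

text \<open>At the point 1 the series is the sum of its coefficients, whose partial sums are
  truncations of \<open>mzv a\<close>. The word ends in 1, so the constant series 1 is an allowed
  start.\<close>

lemma nn_integral_binary_word_le_mzv:
  assumes "admissible a" "a \<noteq> []"
  shows "(\<integral>\<^sup>+t. word_form (binary_word a) t \<partial>(\<Pi>\<^sub>M i\<in>{..<length (binary_word a)}. lborel))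
    \<le> ennreal (mzv a)"
proof -
  let ?w = "binary_word a" and ?c = "foldr letter_step (binary_word a) unit_coeff"
  have last: "last ?w = 1"
    using assms by (cases a rule: rev_cases) (auto simp: binary_word_def)
  have one: "power_series unit_coeff x = 1" for x
    unfolding power_series_def by (subst suminf_finite[where N="{0}"]) (auto simp: unit_coeff_def)
  have nonneg: "0 \<le> foldr letter_step w unit_coeff n" for w n
    by (induction w arbitrary: n) (simp_all add: unit_coeff_def letter_step_nonneg)
  have "(\<integral>\<^sup>+t. word_form ?w t \<partial>(\<Pi>\<^sub>M i\<in>{..<length ?w}. lborel)) = power_series ?c 1"
    using nn_integral_word_form[of unit_coeff ?w] last by (simp add: one unit_coeff_def)
  also have "\<dots> \<le> ennreal (mzv a)"
    unfolding power_series_def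
  proof (rule suminf_le_const)
    fix N
    have "0 \<le> mzv a"
      using trunc_mzv_le_mzv[OF assms, of 0] trunc_mzv_nonneg[of a 0] by linarith
    moreover have "(\<Sum>n<N. ?c n) = trunc_mzv a N" if "0 < N"
      using assms that by (intro sum_coeff_binary_word) (auto simp: admissible_def)
    ultimately have "(\<Sum>n<N. ?c n) \<le> mzv a"
      using trunc_mzv_le_mzv[OF assms, of N] by (cases "N = 0") auto
    then show "(\<Sum>n<N. ennreal (?c n * 1 ^ n)) \<le> ennreal (mzv a)"
      using nonneg by (simp add: sum_ennreal ennreal_leI)
  qed simp
  finally show ?thesis .
qed

section \<open>The weight \<open>(1 - t) ^ m * t ^ n\<close> and the final estimates\<close>

lemma power_mult_power_le:
  fixes t :: real
  assumes "0 \<le> t" "t \<le> 1"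
  shows "(1 - t) ^ m * t ^ n \<le> real m ^ m * real n ^ n / real (m + n) ^ (m + n)"
proof (cases "m = 0 \<or> n = 0")
  \<comment> \<open>By \<open>0 ^ 0 = 1\<close> the right-hand constant is 1 here.\<close>
  case True
  then show ?thesis using assms by (auto simp: power_le_one)
next
  case False
  \<comment> \<open>\<open>p\<close> and \<open>q\<close> are \<open>1 - t\<close> and
    \<open>t\<close> divided by their values \<open>m / s\<close> and \<open>n / s\<close> at the
    maximum, so the claim becomes \<open>p ^ m * q ^ n \<le> 1\<close>. It follows from
    \<open>u \<le> exp (u - 1)\<close>, because the exponents add up to 0.\<close>
  define s where "s = real m + real n"
  define p where "p = s * (1 - t) / real m"
  define q where "q = s * t / real n"
  have s: "0 < s" using False by (simp add: s_def)
  have pq: "0 \<le> p" "0 \<le> q" using s assms by (auto simp: p_def q_def)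
  have "p ^ m * q ^ n \<le> exp (p - 1) ^ m * exp (q - 1) ^ n"
    using pq exp_ge_add_one_self[of "p - 1"] exp_ge_add_one_self[of "q - 1"]
    by (intro mult_mono power_mono) auto
  also have "\<dots> = exp (real m * (p - 1) + real n * (q - 1))"
    by (simp add: exp_add exp_of_nat_mult)
  also have "real m * (p - 1) + real n * (q - 1) = 0"
    using False by (simp add: p_def q_def s_def field_simps)
  finally have "p ^ m * q ^ n \<le> 1" by simp
  moreover have "p ^ m * q ^ n = s ^ (m + n) * ((1 - t) ^ m * t ^ n) / (real m ^ m * real n ^ n)"
    by (simp add: p_def q_def power_mult_distrib power_divide power_add)
  ultimately show ?thesis
    using False s by (simp add: s_def field_simps)
qed

lemma simplex_form_le_word_form:
  assumes t: "t \<in> open_simplex (length w)" and w: "w \<noteq> []"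
  shows "ennreal ((1 - t 0) ^ m * (\<Prod>i<length w. letter_form (w ! i) (t i)) * t (length w - 1) ^ n)
    \<le> ennreal (real m ^ m * real n ^ n / real (m + n) ^ (m + n)) * word_form w t"
proof -
  let ?P = "\<Prod>i<length w. letter_form (w ! i) (t i)"
  let ?C = "real m ^ m * real n ^ n / real (m + n) ^ (m + n)"
  have rng: "0 < t i" "t i < 1" if "i < length w" for i
    using t that by (auto simp: open_simplex_def)
  have dec: "t j < t i" if "i < j" "j < length w" for i j
    using t that by (auto simp: open_simplex_def)
  have pos: "0 \<le> letter_form (w ! i) (t i)" if "i < length w" for i
    using rng[OF that] by (auto simp: letter_form_def)
  then have P: "0 \<le> ?P" by (intro prod_nonneg) auto
  have k: "0 < length w" using w by simp
  have "t (length w - 1) \<le> t 0"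
    using dec[of 0 "length w - 1"] k by (cases "length w = 1") auto
  then have "(1 - t 0) ^ m * t (length w - 1) ^ n \<le> (1 - t 0) ^ m * t 0 ^ n"
    using rng[of 0] rng[of "length w - 1"] k by (intro mult_left_mono power_mono) auto
  also have "\<dots> \<le> ?C"
    using rng[of 0] k by (intro power_mult_power_le) auto
  finally have "(1 - t 0) ^ m * t (length w - 1) ^ n * ?P \<le> ?C * ?P"
    by (intro mult_right_mono P)
  then have "ennreal ((1 - t 0) ^ m * ?P * t (length w - 1) ^ n) \<le> ennreal ?C * ennreal ?P"
    using P by (subst ennreal_mult[symmetric]) (auto simp: mult_ac intro!: ennreal_leI)
  also have "ennreal ?P = (\<Prod>i<length w. ennreal (letter_form (w ! i) (t i)))"
    using pos by (intro prod_ennreal[symmetric]) auto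
  \<comment> \<open>On the simplex every indicator in \<open>word_form\<close> is 1; for the first
    coordinate this says \<open>t 0 < 1\<close>.\<close>
  also have "\<dots> = word_form w t"
    unfolding word_form_def
  proof (rule prod.cong)
    fix i assume i: "i \<in> {..<length w}"
    then have "t i < pred_coord t i"
      using rng[of i] dec[of "i - 1" i] by (auto simp: pred_coord_def)
    with rng[of i] i show "ennreal (letter_form (w ! i) (t i))
      = indicator {0<..<pred_coord t i} (t i) * ennreal (letter_form (w ! i) (t i))"
      by simp
  qed simp
  finally show ?thesis .
qed

lemma mzv_tail_le:
  assumes "admissible a" "a \<noteq> []"
  shows "mzv_tail a m n \<le> real m ^ m * real n ^ n / real (m + n) ^ (m + n) * mzv a"
proof -
  let ?w = "binary_word a"
  let ?M = "\<Pi>\<^sub>M i\<in>{..<length ?w}. lborel :: real measure"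
  let ?C = "real m ^ m * real n ^ n / real (m + n) ^ (m + n)"
  let ?f = "\<lambda>t. (1 - t 0) ^ m * (\<Prod>i<length ?w. letter_form (?w ! i) (t i)) * t (length ?w - 1) ^ n"
  have w: "?w \<noteq> []" using assms(2) by (cases a) (auto simp: binary_word_def)
  have mzv: "0 \<le> mzv a"
    using trunc_mzv_le_mzv[OF assms, of 0] trunc_mzv_nonneg[of a 0] by linarith
  have "(\<integral>\<^sup>+t. ennreal (indicator (open_simplex (length ?w)) t *\<^sub>R ?f t) \<partial>?M)
      \<le> (\<integral>\<^sup>+t. ennreal ?C * word_form ?w t \<partial>?M)"
    using simplex_form_le_word_form[OF _ w, of _ m n]
    by (intro nn_integral_mono) (auto simp: indicator_def)
  also have "\<dots> = ennreal ?C * (\<integral>\<^sup>+t. word_form ?w t \<partial>?M)"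
    by (intro nn_integral_cmult measurable_word_form) simp
  also have "\<dots> \<le> ennreal ?C * ennreal (mzv a)"
    by (intro mult_left_mono nn_integral_binary_word_le_mzv assms) simp
  also have "\<dots> = ennreal (?C * mzv a)"
    using mzv by (intro ennreal_mult[symmetric]) auto
  \<comment> \<open>Passing to the real-valued integral uses that the bound is nonnegative, which
    covers the default value 0 of a non-integrable function.\<close>
  finally have "(\<integral>t. indicator (open_simplex (length ?w)) t *\<^sub>R ?f t \<partial>?M) \<le> ?C * mzv a"
    using mzv by (intro integral_real_bounded) auto
  then show ?thesis
    by (simp add: mzv_tail_def Let_def set_lebesgue_integral_def)
qed

theorem theorem3:
  fixes a :: "nat list"
  assumes "admissible a" and "a \<noteq> []"
  shows "(\<forall>m n :: nat. mzv_tail a m n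
            \<le> real m ^ m * real n ^ n / real (m + n) ^ (m + n) * mzv a)
    \<and> mzv a \<le> pi\<^sup>2 / 6
    \<and> (\<forall>n :: nat. mzv_tail a n n \<le> 1 / 2 ^ (2 * n) * mzv a
          \<and> 1 / 2 ^ (2 * n) * mzv a \<le> 1 / 2 ^ (2 * n) * (pi\<^sup>2 / 6))"
proof (intro conjI allI)
  fix m n
  show "mzv_tail a m n \<le> real m ^ m * real n ^ n / real (m + n) ^ (m + n) * mzv a"
    by (rule mzv_tail_le[OF assms])
next
  show "mzv a \<le> pi\<^sup>2 / 6"
    by (rule mzv_le_zeta2[OF assms])
next
  fix n
  have "real n ^ n * real n ^ n / real (n + n) ^ (n + n) = 1 / 2 ^ (2 * n)"
  proof (cases "n = 0")
    case False
    have "real (n + n) ^ (n + n) = 2 ^ (2 * n) * (real n ^ n * real n ^ n)"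
      by (simp add: mult_2[symmetric] power_mult_distrib) (simp add: mult_2 power_add)
    with False show ?thesis by simp
  qed simp
  with mzv_tail_le[OF assms, of n n] show "mzv_tail a n n \<le> 1 / 2 ^ (2 * n) * mzv a"
    by metis
next
  fix n
  show "1 / 2 ^ (2 * n) * mzv a \<le> 1 / 2 ^ (2 * n) * (pi\<^sup>2 / 6)"
    by (intro mult_left_mono mzv_le_zeta2 assms) simp
qed

end
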